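(* Let $X,Z$ be normed spaces, $\Omega\subset X$, $F:\Omega\rightrightarrows\mathbb{R}$ and $G:\Omega\rightrightarrows Z$ set-valued maps, and $U\subset Z$ an open neighborhood of $0_Z$ such that $F(G^{-1}(z)):=\bigcup_{x\in\Omega,\ z\in G(x)}F(x)\neq\varnothing$ for every $z\in U$. Let $$r_0:=\inf\bigcup_{x\in\Omega,\ 0_Z\in G(x)}F(x),$$ and assume $r_0\in\mathbb{R}$. Let $\mathcal{S}_{r_0}$ be the set of all lower semicontinuous sublinear functions $\varphi:Z\to\mathbb{R}$ such that, for every $z\in Z\setminus\{0_Z\}$, $-\varphi(z)<r-r_0$ for all $r\in F(G^{-1}(z))$, and assume $\mathcal{S}_{r_0}\neq\varnothing$. Then every $\varphi\in\mathcal{S}_{r_0}$ is a Lagrange multiplier of $(P(0_Z))$ at $r_0$; that is, $r_0$ is the infimum of the program "Minimize $F(x)+\varphi(G(x))$ subject to $x\in\Omega$" (denoted $(P[\varphi])$): $$r_0=\inf\bigcup_{x\in\Omega}\bigl(F(x)+\varphi(G(x))\bigr).$$ Furthermore, if $r_0\in F(x_0)$ for some $x_0\in\Omega$ with $0_Z\in G(x_0)$, then $r_0$ is also a minimal point of $(P[\varphi])$ achieved at $x_0$ (i.e. $r_0\in F(x_0)+\varphi(G(x_0))$ and $r_0$ is the minimum of $\bigcup_{x\in\Omega}(F(x)+\varphi(G(x)))$), and $$\varphi(z)\ge0\quad\text{for every } z\in G(x_0).$$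
   Context: All normed spaces are real. $G^{-1}(z)=\{x\in\Omega:z\in G(x)\}$; $\varphi(G(x))=\{\varphi(z):z\in G(x)\}$; sums of sets are Minkowski sums, with $A+\varnothing=\varnothing$. $\varphi:Z\to\mathbb{R}$ is sublinear if $\varphi(\lambda x)=\lambda\varphi(x)$ and $\varphi(x+y)\le\varphi(x)+\varphi(y)$ for all $x,y\in Z$, $\lambda\ge0$. $(P(0_Z))$ is the program "Minimize $F(x)$ subject to $x\in\Omega$, $0_Z\in G(x)$". *)

theory Defs
  imports "HOL-Analysis.Analysis"
begin

text \<open>
  A set-valued map from \<open>\<Omega>\<close> to \<open>'b\<close> is a function of type \<open>'a \<Rightarrow> 'b set\<close>, possibly with empty
  values; every notion below inspects it at points of \<open>\<Omega>\<close> only.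
  Sums of sets are the Minkowski sums of \<^theory>\<open>HOL-Library.Set_Algebras\<close>.
\<close>

definition sv_inverse :: "'a set \<Rightarrow> ('a \<Rightarrow> 'b set) \<Rightarrow> 'b \<Rightarrow> 'a set"
  where "sv_inverse \<Omega> G z = {x \<in> \<Omega>. z \<in> G x}"

definition sv_image :: "('a \<Rightarrow> 'b set) \<Rightarrow> 'a set \<Rightarrow> 'b set"
  where "sv_image F A = (\<Union>x\<in>A. F x)"

definition sublinear :: "('z::real_vector \<Rightarrow> real) \<Rightarrow> bool"
  where "sublinear \<phi> \<longleftrightarrow>
    (\<forall>c x. 0 \<le> c \<longrightarrow> \<phi> (c *\<^sub>R x) = c * \<phi> x) \<and> (\<forall>x y. \<phi> (x + y) \<le> \<phi> x + \<phi> y)"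

definition lower_semicontinuous :: "('z::topological_space \<Rightarrow> real) \<Rightarrow> bool"
  where "lower_semicontinuous \<phi> \<longleftrightarrow> (\<forall>x. \<forall>a < \<phi> x. \<forall>\<^sub>F y in nhds x. a < \<phi> y)"

text \<open>
  For the program ``minimize \<open>H x\<close> subject to \<open>x \<in> A\<close>'' with set-valued objective \<open>H\<close>, the infimum is
  taken in the extended reals, since \<^term>\<open>Inf\<close> on \<^typ>\<open>real\<close> is unspecified for sets that are empty
  or unbounded below.
\<close>

definition program_inf :: "('a \<Rightarrow> real set) \<Rightarrow> 'a set \<Rightarrow> ereal"
  where "program_inf H A = (INF r \<in> sv_image H A. ereal r)"

definition minimal_point_at :: "('a \<Rightarrow> real set) \<Rightarrow> 'a set \<Rightarrow> real \<Rightarrow> 'a \<Rightarrow> bool"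
  where "minimal_point_at H A r x \<longleftrightarrow>
    x \<in> A \<and> r \<in> H x \<and> (\<forall>s \<in> sv_image H A. r \<le> s)"

definition lagrangian :: "('a \<Rightarrow> real set) \<Rightarrow> ('a \<Rightarrow> 'z set) \<Rightarrow> ('z \<Rightarrow> real) \<Rightarrow> 'a \<Rightarrow> real set"
  where "lagrangian F G \<phi> x = F x + \<phi> ` G x"

definition lagrange_multiplier_at ::
    "'a set \<Rightarrow> ('a \<Rightarrow> real set) \<Rightarrow> ('a \<Rightarrow> 'z set) \<Rightarrow> real \<Rightarrow> ('z \<Rightarrow> real) \<Rightarrow> bool"
  where "lagrange_multiplier_at \<Omega> F G r \<phi> \<longleftrightarrow> program_inf (lagrangian F G \<phi>) \<Omega> = ereal r"

definition strict_supports ::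
    "'a set \<Rightarrow> ('a \<Rightarrow> real set) \<Rightarrow> ('a \<Rightarrow> 'z::real_normed_vector set) \<Rightarrow> real \<Rightarrow> ('z \<Rightarrow> real) set"
  where "strict_supports \<Omega> F G r\<^sub>0 =
    {\<phi>. lower_semicontinuous \<phi> \<and> sublinear \<phi> \<and>
        (\<forall>z. z \<noteq> 0 \<longrightarrow> (\<forall>r \<in> sv_image F (sv_inverse \<Omega> G z). - \<phi> z < r - r\<^sub>0))}"

end

theory Submission
  imports Defs
begin

text \<open>The multiplier property comes from two opposite comparisons. A Lagrangian value has the
  form \<open>r + \<phi> z\<close> with \<open>r \<in> F x\<close> and \<open>z \<in> G x\<close>,
  so \<open>r\<close> is one of the values constrained at \<open>z\<close> in the definition of
  \<open>strict_supports\<close>. For \<open>z\<close> nonzero this keeps the sum above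
  \<open>r\<^sub>0\<close>; for \<open>z = 0\<close> the penalty vanishes and \<open>r\<close> is a
  feasible value of the original program (\<open>strict_supports_lagrangian_ge\<close>). Conversely,
  since \<open>\<phi> 0 = 0\<close>, each feasible value is itself a Lagrangian value
  (\<open>subset_lagrangian\<close>), so passing to the Lagrangian can only lower the infimum. Hence
  the two infima agree, and a minimizer of the original program stays one.\<close>

lemma sublinear_zero: "\<phi> 0 = 0" if "sublinear \<phi>"
proof -
  have "\<phi> (0 *\<^sub>R 0) = 0 * \<phi> 0"
    using that unfolding sublinear_def by blast
  then show ?thesis
    by simp
qed

lemma sv_image_sv_inverseI: "r \<in> sv_image F (sv_inverse \<Omega> G z)" if "x \<in> \<Omega>" "z \<in> G x" "r \<in> F x"
  using that unfolding sv_image_def sv_inverse_def by blast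

lemma program_inf_le: "program_inf H A \<le> ereal r" if "r \<in> sv_image H A"
  using that unfolding program_inf_def by (rule INF_lower)

text \<open>The support inequality says nothing at the origin, hence the case split: there the bound
  comes from \<open>r\<^sub>0\<close> being the infimum over feasible points.\<close>

lemma strict_supports_lagrangian_ge:
  fixes G :: "'x \<Rightarrow> 'z::real_normed_vector set"
  assumes inf: "program_inf F (sv_inverse \<Omega> G 0) = ereal r\<^sub>0"
    and \<phi>: "\<phi> \<in> strict_supports \<Omega> F G r\<^sub>0"
    and x: "x \<in> \<Omega>" "z \<in> G x" "r \<in> F x"
  shows "r\<^sub>0 \<le> r + \<phi> z"
proof (cases "z = 0")
  case True
  have "\<phi> 0 = 0"
    using \<phi> by (simp add: strict_supports_def sublinear_zero)
  moreover have "ereal r\<^sub>0 \<le> ereal r"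
    using program_inf_le[OF sv_image_sv_inverseI[of x \<Omega> 0 G r F]] x True inf by simp
  ultimately show ?thesis
    using True by simp
next
  case False
  then have "- \<phi> z < r - r\<^sub>0"
    using \<phi> sv_image_sv_inverseI[of x \<Omega> z G r F, OF x] by (simp add: strict_supports_def)
  then show ?thesis
    by simp
qed

text \<open>At a feasible point, choosing \<open>0 \<in> G x\<close> adds the penalty
  \<open>\<phi> 0 = 0\<close>.\<close>

lemma subset_lagrangian: "F x \<subseteq> lagrangian F G \<phi> x" if "\<phi> 0 = 0" "0 \<in> G x"
proof
  fix r assume "r \<in> F x"
  moreover have "0 \<in> \<phi> ` G x"
    using that by (metis imageI)
  ultimately show "r \<in> lagrangian F G \<phi> x"
    unfolding lagrangian_def using set_plus_intro[of r "F x" 0 "\<phi> ` G x"] by simp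
qed

theorem theorem3p13:
  fixes \<Omega> :: "'x::real_normed_vector set"
    and F :: "'x \<Rightarrow> real set"
    and G :: "'x \<Rightarrow> 'z::real_normed_vector set"
    and U :: "'z set"
    and r\<^sub>0 :: real
  assumes "open U" and "0 \<in> U"
    and "\<And>z. z \<in> U \<Longrightarrow> sv_image F (sv_inverse \<Omega> G z) \<noteq> {}"
    and "program_inf F (sv_inverse \<Omega> G 0) = ereal r\<^sub>0"
    and "strict_supports \<Omega> F G r\<^sub>0 \<noteq> {}"
  shows "\<forall>\<phi> \<in> strict_supports \<Omega> F G r\<^sub>0.
    lagrange_multiplier_at \<Omega> F G r\<^sub>0 \<phi> \<and>
    (\<forall>x\<^sub>0 \<in> \<Omega>. 0 \<in> G x\<^sub>0 \<and> r\<^sub>0 \<in> F x\<^sub>0 \<longrightarrow>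
       minimal_point_at (lagrangian F G \<phi>) \<Omega> r\<^sub>0 x\<^sub>0 \<and> (\<forall>z \<in> G x\<^sub>0. 0 \<le> \<phi> z))"
proof (intro ballI conjI impI)
  fix \<phi> assume \<phi>: "\<phi> \<in> strict_supports \<Omega> F G r\<^sub>0"
  then have \<phi>0: "\<phi> 0 = 0"
    by (simp add: strict_supports_def sublinear_zero)
  have sub: "F x \<subseteq> lagrangian F G \<phi> x" if "0 \<in> G x" for x
    using \<phi>0 that by (rule subset_lagrangian)
  note ge = strict_supports_lagrangian_ge[OF assms(4) \<phi>]
  have lower: "r\<^sub>0 \<le> s" if "s \<in> sv_image (lagrangian F G \<phi>) \<Omega>" for s
  proof -
    obtain x r z where "x \<in> \<Omega>" "z \<in> G x" "r \<in> F x" "s = r + \<phi> z"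
      using \<open>s \<in> _\<close> unfolding sv_image_def lagrangian_def
      by (elim UN_E set_plus_elim imageE) blast
    then show ?thesis
      using ge by simp
  qed
  show "lagrange_multiplier_at \<Omega> F G r\<^sub>0 \<phi>"
    unfolding lagrange_multiplier_at_def
  proof (rule antisym)
    have "sv_image F (sv_inverse \<Omega> G 0) \<subseteq> sv_image (lagrangian F G \<phi>) \<Omega>"
      using sub unfolding sv_image_def sv_inverse_def by blast
    then show "program_inf (lagrangian F G \<phi>) \<Omega> \<le> ereal r\<^sub>0"
      \<comment> \<open>Writing \<open>r\<^sub>0\<close> back as the original infimum turns the
        bound into antitonicity of infima under inclusion.\<close>
      unfolding assms(4)[symmetric] program_inf_def by (rule INF_superset_mono) simp
    show "ereal r\<^sub>0 \<le> program_inf (lagrangian F G \<phi>) \<Omega>"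
      unfolding program_inf_def using lower by (intro INF_greatest) simp
  qed
  fix x\<^sub>0 assume x\<^sub>0: "x\<^sub>0 \<in> \<Omega>" "0 \<in> G x\<^sub>0 \<and> r\<^sub>0 \<in> F x\<^sub>0"
  then show "minimal_point_at (lagrangian F G \<phi>) \<Omega> r\<^sub>0 x\<^sub>0"
    using sub[of x\<^sub>0] lower unfolding minimal_point_at_def by (simp add: subset_iff)
  \<comment> \<open>Taking the attained value \<open>r = r\<^sub>0\<close> in the lower bound gives
    \<open>r\<^sub>0 \<le> r\<^sub>0 + \<phi> z\<close>, and \<open>r\<^sub>0\<close>
    cancels.\<close>
  show "0 \<le> \<phi> z" if "z \<in> G x\<^sub>0" for z
    using ge[of x\<^sub>0 z r\<^sub>0] x\<^sub>0 that by simp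
qed

end
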